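(* Fix any constant $\epsilon>0$. If $m\ge n^{2.988+\epsilon}$, then the binary tree algorithm described below incurs zero inversions with probability $1-o(1)$ (as $n\to\infty$).
   Context: Secretary ranking problem: $n$ elements with distinct values from a totally ordered set arrive online in uniformly random order; at time $t$ the algorithm knows only comparisons among the elements arrived so far and irrevocably assigns the arriving element a free position in $[m]$; an inversion is a pair of elements whose positions are in the opposite order to their true order. Binary tree algorithm: take a complete binary tree of some height $\bar h$ with $2^{\bar h+1}-1\le m$ nodes, and associate distinct positions to its nodes so that each node's position is larger than all positions in its left subtree and smaller than all positions in its right subtree. Arriving elements are inserted one by one into this tree as into a binary search tree (starting at the root, moving to the left child if smaller than the element at the current node and to the right child otherwise, until an empty node is reached), and each element is placed at the position of the node it occupies. If some element would need to be inserted at a depth exceeding $\bar h$, from then on elements are allocated to free positions arbitrarily. Here $\bar h$ is chosen as large as possible subject to $2^{\bar h+1}-1\le m$.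
   Formalization: The exponent 2.988 is replaced by the exact constant α ln 2 = 2.98820…, where α ≥ 2 solves α ln(2e/α) = 1; with literally 2.988 the claim fails for ε < 0.0002, since the random search tree then overflows with high probability; all larger ε with 2.988+ε > α ln 2 are covered. *)

theory Defs
  imports
    "HOL-Probability.Probability"
    "HOL-Combinatorics.Multiset_Permutations"
    "HOL-Library.Tree"
    "HOL-Library.Landau_Symbols"
begin

section \<open>The binary tree algorithm\<close>

text \<open>A tree node carries its position together with the element occupying it, if any.
  Insertion returns the position of the node that is reached and the updated tree, or
  \<^const>\<open>None\<close> if the element would have to be placed below the bottom level.\<close>

fun insert_elem ::
  "'a::linorder \<Rightarrow> (nat \<times> 'a option) tree \<Rightarrow> (nat \<times> (nat \<times> 'a option) tree) option"
where
  "insert_elem x \<langle>\<rangle> = None"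
| "insert_elem x \<langle>l, (p, None), r\<rangle> = Some (p, \<langle>l, (p, Some x), r\<rangle>)"
| "insert_elem x \<langle>l, (p, Some y), r\<rangle> =
     (if x < y
      then map_option (\<lambda>(q, l'). (q, \<langle>l', (p, Some y), r\<rangle>)) (insert_elem x l)
      else map_option (\<lambda>(q, r'). (q, \<langle>l, (p, Some y), r'\<rangle>)) (insert_elem x r))"

text \<open>A placement is the list of pairs (element, position) in order of arrival. A fallback rule
  sees the placement so far and the arriving element, and selects a position.
  The state \<^const>\<open>None\<close> means that some insertion has already exceeded the maximal depth.\<close>

type_synonym 'a placement = "('a \<times> nat) list"
type_synonym 'a fallback = "'a placement \<Rightarrow> 'a \<Rightarrow> nat"

fun place_elem ::
  "'a::linorder fallback \<Rightarrow> 'a \<Rightarrow> (nat \<times> 'a option) tree option \<times> 'a placement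
    \<Rightarrow> (nat \<times> 'a option) tree option \<times> 'a placement"
where
  "place_elem fb x (None, ps) = (None, ps @ [(x, fb ps x)])"
| "place_elem fb x (Some T, ps) =
     (case insert_elem x T of
        None \<Rightarrow> (None, ps @ [(x, fb ps x)])
      | Some (p, T') \<Rightarrow> (Some T', ps @ [(x, p)]))"

definition binary_tree_alg ::
  "nat tree \<Rightarrow> 'a::linorder fallback \<Rightarrow> 'a list \<Rightarrow> 'a placement"
where
  "binary_tree_alg P fb xs =
     snd (fold (place_elem fb) xs (Some (map_tree (\<lambda>p. (p, None)) P), []))"

text \<open>``Arbitrarily'': any rule that selects a free position in \<open>[m]\<close> as long as there is one.\<close>

definition fallback_rule :: "nat \<Rightarrow> 'a fallback \<Rightarrow> bool" where
  "fallback_rule m fb \<longleftrightarrow>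
     (\<forall>ps x. \<not> {1..m} \<subseteq> snd ` set ps \<longrightarrow> fb ps x \<in> {1..m} - snd ` set ps)"

text \<open>Depths are counted in edges, whereas \<^const>\<open>height\<close> counts levels; a complete tree of
  maximal depth \<open>h\<close> thus has \<^const>\<open>height\<close> \<open>h + 1\<close> and \<open>2 ^ (h + 1) - 1\<close> nodes. The greatest
  such \<open>h\<close> exists for \<open>m \<ge> 1\<close>.\<close>

definition max_depth :: "nat \<Rightarrow> nat" where
  "max_depth m = (GREATEST h. 2 ^ (h + 1) - 1 \<le> m)"

lemma max_depth_bounds:
  assumes "m \<ge> 1"
  shows "2 ^ (max_depth m + 1) - 1 \<le> m" "m < 2 ^ (max_depth m + 2) - 1"
proof -
  let ?Q = "\<lambda>h::nat. 2 ^ (h + 1) - 1 \<le> m"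
  have bound: "h \<le> m" if "?Q h" for h
    using that less_exp[of "h + 1"] by linarith
  show "2 ^ (max_depth m + 1) - 1 \<le> m"
    unfolding max_depth_def
  proof (rule GreatestI_nat)
    show "?Q 0" using assms by simp
  qed (rule bound)
  show "m < 2 ^ (max_depth m + 2) - 1"
  proof (rule ccontr)
    assume "\<not> ?thesis"
    then have "?Q (max_depth m + 1)" by (simp add: not_less)
    from Greatest_le_nat[of ?Q, OF this bound] show False by (simp add: max_depth_def)
  qed
qed

definition position_tree :: "nat \<Rightarrow> nat tree \<Rightarrow> bool" where
  "position_tree m P \<longleftrightarrow>
     complete P \<and> height P = max_depth m + 1 \<and> bst P \<and> set_tree P \<subseteq> {1..m}"

definition inversions :: "'a::linorder placement \<Rightarrow> nat" where
  "inversions ps =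
     card {(x, y). x < y \<and> (\<exists>p q. (x, p) \<in> set ps \<and> (y, q) \<in> set ps \<and> q < p)}"


section \<open>The exponent\<close>

text \<open>The height of a random binary search tree on \<open>n\<close> nodes is \<open>(\<alpha> + o(1)) ln n\<close> (Devroye),
  where \<open>\<alpha> = 4.31107\<dots>\<close> is the solution in \<open>[2, \<infinity>)\<close> of \<open>\<alpha> ln (2 e / \<alpha>) = 1\<close>. The exponent written
  as 2.988 is \<open>\<alpha> ln 2 = 2.98820\<dots>\<close> to three decimals. It has to be read
  as an abbreviation of this constant: since it is slightly larger than the decimal 2.988, for
  small \<open>\<epsilon>\<close> an exponent of literally \<open>2.988 + \<epsilon>\<close> gives trees that are too shallow.\<close>

definition bst_const :: real where
  "bst_const = (THE c. c \<ge> 2 \<and> c * ln (2 * exp 1 / c) = 1)"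

definition bst_exponent :: real where
  "bst_exponent = bst_const * ln 2"

lemma bst_const_fun_strict_antimono:
  fixes c d :: real
  assumes "2 \<le> c" "c < d"
  shows "d * ln (2 * exp 1 / d) < c * ln (2 * exp 1 / c)"
proof -
  have "\<exists>y. ((\<lambda>c. c * ln (2 * exp 1 / c)) has_real_derivative y) (at x) \<and> y < 0"
    if "c < x" "x < d" for x :: real
  proof (intro exI conjI)
    show "((\<lambda>c. c * ln (2 * exp 1 / c)) has_real_derivative (ln (2 * exp 1 / x) - 1)) (at x)"
      using that assms by (auto intro!: derivative_eq_intros simp: field_simps power2_eq_square)
    have "ln (2 * exp 1 / x) = ln 2 + 1 - ln x"
      using that assms by (simp add: ln_div ln_mult)
    moreover have "ln 2 < ln x" using that assms by simp
    ultimately show "ln (2 * exp 1 / x) - 1 < 0" by simp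
  qed
  moreover have "continuous_on {c..d} (\<lambda>c. c * ln (2 * exp 1 / c))"
    using assms by (auto intro!: continuous_intros)
  ultimately show ?thesis
    using DERIV_neg_imp_decreasing_open[of c d "\<lambda>c. c * ln (2 * exp 1 / c)"] assms by blast
qed

lemma ln_bounds:
  "ln (2::real) > 0.693147" "ln (2::real) < 0.6931475"
  "ln (4.311::real) < 1.46118" "ln (4.3111::real) > 1.46119"
proof -
  show l: "ln (2::real) > 0.693147" and u: "ln (2::real) < 0.6931475"
    using ln_approx_bounds[of 2 6] by (simp_all add: eval_nat_numeral)
  have 4: "ln (4::real) = 2 * ln 2"
    using ln_realpow[of 2 2] by simp
  have "ln (1.07775::real) < 0.07488"
    using ln_approx_bounds[of "1.07775" 2] by (simp add: eval_nat_numeral)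
  moreover have "ln (4.311::real) = 2 * ln 2 + ln 1.07775"
    using ln_mult[of 4 "1.07775::real"] 4 by simp
  ultimately show "ln (4.311::real) < 1.46118" using u by simp
  have "ln (1.077775::real) > 0.074898"
    using ln_approx_bounds[of "1.077775" 2] by (simp add: eval_nat_numeral)
  moreover have "ln (4.3111::real) = 2 * ln 2 + ln 1.077775"
    using ln_mult[of 4 "1.077775::real"] 4 by simp
  ultimately show "ln (4.3111::real) > 1.46119" using l by simp
qed

lemma bst_const_bracket:
  "4.311 * ln (2 * exp 1 / 4.311) > (1::real)" "4.3111 * ln (2 * exp 1 / 4.3111) < (1::real)"
proof -
  have *: "ln (2 * exp 1 / c) = ln 2 + 1 - ln c" if "c > 0" for c :: real
    using that by (simp add: ln_div ln_mult)
  show "4.311 * ln (2 * exp 1 / 4.311) > (1::real)"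
    using ln_bounds(1,3) by (subst *) (simp_all add: field_simps)
  show "4.3111 * ln (2 * exp 1 / 4.3111) < (1::real)"
    using ln_bounds(2,4) by (subst *) (simp_all add: field_simps)
qed

lemma bst_const_ex1: "\<exists>!c::real. c \<ge> 2 \<and> c * ln (2 * exp 1 / c) = 1"
proof -
  have "\<exists>c::real. 4.311 \<le> c \<and> c \<le> 4.3111 \<and> c * ln (2 * exp 1 / c) = 1"
    using bst_const_bracket by (intro IVT2') (auto intro!: continuous_intros)
  then obtain c :: real where "c \<ge> 2" "c * ln (2 * exp 1 / c) = 1"
  proof (elim exE conjE)
    fix c :: real
    assume "4.311 \<le> c" "c * ln (2 * exp 1 / c) = 1"
    then show thesis by (intro that[of c]) simp_all
  qed
  moreover have "d = c" if "d \<ge> 2" "d * ln (2 * exp 1 / d) = 1" for d :: real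
    using bst_const_fun_strict_antimono[of c d] bst_const_fun_strict_antimono[of d c] that
      \<open>c \<ge> 2\<close> \<open>c * ln (2 * exp 1 / c) = 1\<close> by linarith
  ultimately show ?thesis by blast
qed

lemma bst_const_props: "bst_const \<ge> 2" "bst_const * ln (2 * exp 1 / bst_const) = 1"
  using theI'[OF bst_const_ex1] unfolding bst_const_def by blast+

lemma bst_const_bounds: "4.311 < bst_const" "bst_const < 4.3111"
proof -
  note mono = bst_const_fun_strict_antimono
  show "4.311 < bst_const"
  proof (rule ccontr)
    assume "\<not> 4.311 < bst_const"
    then consider "bst_const = 4.311" | "bst_const < 4.311" by linarith
    then show False
    proof cases
      case 1
      from bst_const_props(2)[unfolded 1] bst_const_bracket(1) show False by linarith
    next
      case 2
      from mono[OF bst_const_props(1) this] bst_const_bracket(1) bst_const_props(2)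
      show False by linarith
    qed
  qed
  show "bst_const < 4.3111"
  proof (rule ccontr)
    assume "\<not> bst_const < 4.3111"
    then consider "bst_const = 4.3111" | "4.3111 < bst_const" by linarith
    then show False
    proof cases
      case 1
      from bst_const_props(2)[unfolded 1] bst_const_bracket(2) show False by linarith
    next
      case 2
      have "(2::real) \<le> 4.3111" by simp
      from mono[OF this 2] bst_const_bracket(2) bst_const_props(2)
      show False by linarith
    qed
  qed
qed

lemma bst_exponent_bounds: "2.988 < bst_exponent" "bst_exponent < 2.9883"
proof -
  have "4.311 * 0.693147 < bst_const * ln 2"
    using bst_const_bounds ln_bounds by (intro mult_strict_mono) auto
  then show "2.988 < bst_exponent" by (simp add: bst_exponent_def)
  have "bst_const * ln 2 < 4.3111 * 0.6931475"
    using bst_const_bounds ln_bounds by (intro mult_strict_mono) auto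
  then show "bst_exponent < 2.9883" by (simp add: bst_exponent_def)
qed

end

theory Submission
  imports Defs
begin

text \<open>Give an empty slot at depth \<open>d\<close> below the current binary search tree the weight \<open>z ^ d\<close>, and
  let \<open>W\<close> be the total weight. Splitting at the first element, \<open>E W\<^sub>n = (2 z / n) * (\<Sum>k<n. E W\<^sub>k)\<close>,
  so \<open>E W\<^sub>n\<close> is the Pochhammer quotient \<open>(2 z)\<^sub>n / n!\<close>, which is \<open>O(n powr (2 z - 1))\<close>. For \<open>z \<ge> 1\<close>,
  an overflow of a tree with \<open>h\<close> levels forces \<open>W \<ge> z ^ (h + 1)\<close>, so Markov's inequality applies.
  With \<open>z = \<alpha> / 2\<close>, where \<open>\<alpha>\<close> is the constant with \<open>\<alpha> ln (2 e / \<alpha>) = 1\<close>, we have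
  \<open>\<alpha> ln z = \<alpha> - 1 = 2 z - 1\<close>; hence for \<open>m \<ge> n powr (\<alpha> ln 2 + \<epsilon>)\<close> the resulting bound is a negative
  power of \<open>n\<close>. Without overflow, the occupied nodes form a search tree for both positions and
  elements, so there are no inversions.\<close>

section \<open>Insertion into a finite search tree\<close>

definition occupants :: "(nat \<times> 'a option) tree \<Rightarrow> ('a \<times> nat) set" where
  "occupants T = {(x, p). (p, Some x) \<in> set_tree T}"

lemma occupants_simps [simp]:
  "occupants \<langle>\<rangle> = {}"
  "occupants \<langle>l, (p, None), r\<rangle> = occupants l \<union> occupants r"
  "occupants \<langle>l, (p, Some y), r\<rangle> = insert (y, p) (occupants l \<union> occupants r)"
  by (auto simp: occupants_def)

definition positions :: "(nat \<times> 'a option) tree \<Rightarrow> nat set" where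
  "positions T = fst ` set_tree T"

lemma positions_simps [simp]:
  "positions \<langle>\<rangle> = {}"
  "positions \<langle>l, (p, a), r\<rangle> = insert p (positions l \<union> positions r)"
  by (auto simp: positions_def)

lemma occupants_position: "(x, p) \<in> occupants T \<Longrightarrow> p \<in> positions T"
  by (force simp: occupants_def positions_def)

text \<open>Elements and positions obey the search order together. An empty node has no occupants
  below it since nodes fill from the root down; ties go right, as in
  \<open>insert_elem\<close>.\<close>

fun search_tree :: "(nat \<times> 'a::linorder option) tree \<Rightarrow> bool" where
  "search_tree \<langle>\<rangle> \<longleftrightarrow> True"
| "search_tree \<langle>l, (p, a), r\<rangle> \<longleftrightarrow> search_tree l \<and> search_tree r \<and>
     (\<forall>q \<in> positions l. q < p) \<and> (\<forall>q \<in> positions r. p < q) \<and>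
     (case a of
        None \<Rightarrow> occupants l = {} \<and> occupants r = {}
      | Some y \<Rightarrow> (\<forall>(x, q) \<in> occupants l. x < y) \<and> (\<forall>(x, q) \<in> occupants r. y \<le> x))"

text \<open>Two occupants are in the same subtree, where induction applies, or are separated by a
  node that orders elements and positions alike.\<close>

lemma search_tree_mono:
  assumes "search_tree T" "(x, p) \<in> occupants T" "(y, q) \<in> occupants T" "x < y"
  shows "p < q"
  using assms
proof (induction T rule: search_tree.induct)
  case (2 l p' a r)
  show ?case
  proof (cases a)
    case None
    with "2.prems" show ?thesis by auto
  next
    case (Some b)
    have L: "x < b \<and> p < p'" if "(x, p) \<in> occupants l" for x p
      using "2.prems"(1) Some that occupants_position[OF that] by (auto dest: bspec)
    have R: "b \<le> x \<and> p' < p" if "(x, p) \<in> occupants r" for x p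
      using "2.prems"(1) Some that occupants_position[OF that] by (auto dest: bspec)
    have x: "(x, p) = (b, p') \<or> (x, p) \<in> occupants l \<or> (x, p) \<in> occupants r"
      and y: "(y, q) = (b, p') \<or> (y, q) \<in> occupants l \<or> (y, q) \<in> occupants r"
      using "2.prems"(2,3) Some by auto
    from "2.prems"(1) have IH: "(x, p) \<in> occupants l \<Longrightarrow> (y, q) \<in> occupants l \<Longrightarrow> p < q"
      "(x, p) \<in> occupants r \<Longrightarrow> (y, q) \<in> occupants r \<Longrightarrow> p < q"
      using "2.IH" \<open>x < y\<close> by simp_all
    show ?thesis
      using x y L[of x p] L[of y q] R[of x p] R[of y q] IH \<open>x < y\<close>
      by (elim disjE) (auto dest: less_trans leD)
  qed
qed simp

text \<open>Keeping \<open>positions\<close> fixed is what preserves the position bounds at the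
  ancestors.\<close>

lemma insert_elem_search_tree:
  assumes "insert_elem x T = Some (p, T')" "search_tree T"
  shows "search_tree T' \<and> occupants T' = insert (x, p) (occupants T) \<and>
         positions T' = positions T"
  using assms
proof (induction x T arbitrary: p T' rule: insert_elem.induct)
  case (3 x l p' y r)
  show ?case
  proof (cases "x < y")
    case True
    with "3.prems"(1) obtain l' where l': "insert_elem x l = Some (p, l')" "T' = \<langle>l', (p', Some y), r\<rangle>"
      by auto
    show ?thesis
      using "3.IH"(1)[OF True l'(1)] "3.prems" l' True by (auto simp: insert_commute)
  next
    case False
    with "3.prems"(1) obtain r' where r': "insert_elem x r = Some (p, r')" "T' = \<langle>l, (p', Some y), r'\<rangle>"
      by auto
    show ?thesis
      using "3.IH"(2)[OF False r'(1)] "3.prems" r' False by (auto simp: insert_commute)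
  qed
qed auto

text \<open>No element of the list overflows when the list is inserted into the tree.\<close>

fun has_room :: "(nat \<times> 'a::linorder option) tree \<Rightarrow> 'a list \<Rightarrow> bool" where
  "has_room \<langle>\<rangle> xs \<longleftrightarrow> xs = []"
| "has_room \<langle>l, (p, None), r\<rangle> [] \<longleftrightarrow> True"
| "has_room \<langle>l, (p, None), r\<rangle> (x # xs) \<longleftrightarrow>
     has_room l (filter (\<lambda>y. y < x) xs) \<and> has_room r (filter (\<lambda>y. \<not> y < x) xs)"
| "has_room \<langle>l, (p, Some x), r\<rangle> xs \<longleftrightarrow>
     has_room l (filter (\<lambda>y. y < x) xs) \<and> has_room r (filter (\<lambda>y. \<not> y < x) xs)"

text \<open>\<open>has_room\<close> splits the whole remaining list at each node, while the
  algorithm inserts one element at a time. The former controls the latter because an insertion into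
  one subtree leaves the other alone.\<close>

lemma has_room_insert_elem:
  assumes "has_room T (x # xs)"
  shows "\<exists>p T'. insert_elem x T = Some (p, T') \<and> has_room T' xs"
  using assms
proof (induction x T arbitrary: xs rule: insert_elem.induct)
  case (3 x l p' y r)
  show ?case
  proof (cases "x < y")
    case True
    with "3.IH"(1)[of "filter (\<lambda>z. z < y) xs"] "3.prems" obtain q l' where "insert_elem x l = Some (q, l')"
      "has_room l' (filter (\<lambda>z. z < y) xs)" "has_room r (filter (\<lambda>z. \<not> z < y) xs)"
      by auto
    with True show ?thesis by simp
  next
    case False
    with "3.IH"(2)[of "filter (\<lambda>z. \<not> z < y) xs"] "3.prems" obtain q r' where "insert_elem x r = Some (q, r')"
      "has_room r' (filter (\<lambda>z. \<not> z < y) xs)" "has_room l (filter (\<lambda>z. z < y) xs)"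
      by auto
    with False show ?thesis by simp
  qed
qed auto

text \<open>Tree and placement record the same pairs throughout; with room for every element the
  state never becomes \<open>None\<close>, so \<open>fb\<close> is never consulted.\<close>

lemma fold_place_elem_search_tree:
  assumes "has_room T xs" "search_tree T" "occupants T = set ps"
  shows "\<exists>T'. search_tree T' \<and>
           occupants T' = set (snd (fold (place_elem fb) xs (Some T, ps)))"
  using assms
proof (induction xs arbitrary: T ps)
  case (Cons x xs)
  from has_room_insert_elem[OF Cons.prems(1)] obtain p T'
    where T': "insert_elem x T = Some (p, T')" "has_room T' xs" by blast
  from insert_elem_search_tree[OF T'(1) Cons.prems(2)] Cons.prems(3)
  have "search_tree T'" "occupants T' = set (ps @ [(x, p)])" by simp_all
  from Cons.IH[OF T'(2) this] show ?case by (simp add: T'(1))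
qed auto

abbreviation empty_slots :: "nat tree \<Rightarrow> (nat \<times> 'a option) tree" where
  "empty_slots P \<equiv> map_tree (\<lambda>p. (p, None)) P"

lemma occupants_empty_slots [simp]: "occupants (empty_slots P) = {}"
  by (auto simp: occupants_def tree.set_map)

lemma search_tree_empty_slots: "bst P \<Longrightarrow> search_tree (empty_slots P)"
  by (induction P) (auto simp: tree.set_map positions_def)

lemma inversions_eq_0_if_has_room:
  assumes "bst P" "has_room (empty_slots P) xs"
  shows "inversions (binary_tree_alg P fb xs) = 0"
proof -
  from fold_place_elem_search_tree[OF assms(2) search_tree_empty_slots[OF assms(1)], of "[]" fb]
  obtain T' where T': "search_tree T'" "occupants T' = set (binary_tree_alg P fb xs)"
    by (auto simp: binary_tree_alg_def)
  have "{(x, y). x < y \<and> (\<exists>p q. (x, p) \<in> set (binary_tree_alg P fb xs) \<and>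
          (y, q) \<in> set (binary_tree_alg P fb xs) \<and> q < p)} = {}"
    using search_tree_mono[OF T'(1), unfolded T'(2)] by (blast dest: less_asym)
  then show ?thesis by (simp only: inversions_def card.empty)
qed


section \<open>The weight of the empty slots\<close>

text \<open>The first element is the root of an unbounded search tree, the filtered lists build its
  subtrees, and the factor \<open>z\<close> puts one more level above every slot.\<close>

function slot_weight :: "real \<Rightarrow> 'a::linorder list \<Rightarrow> real" where
  "slot_weight z [] = 1"
| "slot_weight z (x # xs) =
     z * (slot_weight z (filter (\<lambda>y. y < x) xs) + slot_weight z (filter (\<lambda>y. \<not> y < x) xs))"
  by pat_completeness auto
termination
  by (relation "Wellfounded.measure (length \<circ> snd)") (simp_all add: less_Suc_eq_le)

lemma slot_weight_ge_1:
  assumes "z \<ge> 1"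
  shows "slot_weight z xs \<ge> 1"
  using assms
proof (induction z xs rule: slot_weight.induct)
  case (2 z x xs)
  then have "1 * 1 \<le> z * (slot_weight z (filter (\<lambda>y. y < x) xs) + slot_weight z (filter (\<lambda>y. \<not> y < x) xs))"
    by (intro mult_mono) auto
  then show ?case by simp
qed simp

text \<open>An overflowing element sits at depth at least \<open>height P\<close> in the unbounded
  tree, with empty slots still deeper. Completeness gives both subtrees the same height, so it does
  not matter which one overflows.\<close>

lemma slot_weight_ge_power:
  assumes "z \<ge> 1" "complete P" "\<not> has_room (empty_slots P) xs"
  shows "slot_weight z xs \<ge> z ^ (height P + 1)"
  using assms(2,3)
proof (induction P arbitrary: xs)
  case Leaf
  then obtain x ys where "xs = x # ys" by (cases xs) auto
  moreover have "z * 1 \<le> z * (slot_weight z (filter (\<lambda>y. y < x) ys) + slot_weight z (filter (\<lambda>y. \<not> y < x) ys))"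
    using assms(1) slot_weight_ge_1[OF assms(1), of "filter (\<lambda>y. y < x) ys"]
      slot_weight_ge_1[OF assms(1), of "filter (\<lambda>y. \<not> y < x) ys"] by (intro mult_left_mono) auto
  ultimately show ?case by simp
next
  case (Node l p r)
  then obtain x ys where xs: "xs = x # ys" by (cases xs) auto
  let ?a = "slot_weight z (filter (\<lambda>y. y < x) ys)"
  let ?b = "slot_weight z (filter (\<lambda>y. \<not> y < x) ys)"
  have "?a \<ge> z ^ (height l + 1) \<or> ?b \<ge> z ^ (height l + 1)"
    using Node xs by auto
  then have "z ^ (height l + 1) \<le> ?a + ?b"
    using slot_weight_ge_1[OF assms(1), of "filter (\<lambda>y. y < x) ys"]
      slot_weight_ge_1[OF assms(1), of "filter (\<lambda>y. \<not> y < x) ys"] by linarith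
  then have "z * z ^ (height l + 1) \<le> z * (?a + ?b)"
    using assms(1) by (intro mult_left_mono) auto
  then show ?case using Node.prems(1) xs by simp
qed

section \<open>Ranks in a finite linear order\<close>

lemma bij_betw_rank:
  fixes S :: "'a::linorder set"
  assumes "finite S"
  shows "bij_betw (\<lambda>x. card {y \<in> S. y < x}) S {..<card S}"
proof -
  have less: "card {y \<in> S. y < x} < card {y \<in> S. y < x'}" if "x \<in> S" "x < x'" for x x'
  proof (rule psubset_card_mono)
    have "{y \<in> S. y < x} \<subseteq> {y \<in> S. y < x'}" "x \<in> {y \<in> S. y < x'}" "x \<notin> {y \<in> S. y < x}"
      using that by auto
    then show "{y \<in> S. y < x} \<subset> {y \<in> S. y < x'}" by blast
  qed (use assms in simp)
  have inj: "inj_on (\<lambda>x. card {y \<in> S. y < x}) S"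
  proof (rule inj_onI)
    fix x y assume "x \<in> S" "y \<in> S" "card {z \<in> S. z < x} = card {z \<in> S. z < y}"
    then show "x = y" using less[of x y] less[of y x] by (cases x y rule: linorder_cases) simp_all
  qed
  moreover have "(\<lambda>x. card {y \<in> S. y < x}) ` S \<subseteq> {..<card S}"
  proof (rule image_subsetI)
    fix x assume "x \<in> S"
    then have "{y \<in> S. y < x} \<subset> S" by blast
    then show "card {y \<in> S. y < x} \<in> {..<card S}"
      using assms by (simp add: psubset_card_mono)
  qed
  ultimately show ?thesis
    using assms by (simp add: bij_betw_def card_image card_subset_eq)
qed

lemma sum_card_less:
  fixes S :: "'a::linorder set" and f :: "nat \<Rightarrow> 'b::comm_monoid_add"
  assumes "finite S"
  shows "(\<Sum>x\<in>S. f (card {y \<in> S. y < x})) = (\<Sum>k<card S. f k)"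
  using sum.reindex_bij_betw[OF bij_betw_rank[OF assms], of f] .

text \<open>The number of elements above \<open>x\<close> is \<open>card S - 1\<close> minus its
  rank, so the sum over ranks runs backwards.\<close>

lemma sum_card_greater:
  fixes S :: "'a::linorder set" and f :: "nat \<Rightarrow> 'b::comm_monoid_add"
  assumes "finite S"
  shows "(\<Sum>x\<in>S. f (card {y \<in> S. x < y})) = (\<Sum>k<card S. f k)"
proof -
  have "card {y \<in> S. x < y} = card S - Suc (card {y \<in> S. y < x})" if "x \<in> S" for x
  proof -
    have "S = insert x ({y \<in> S. y < x} \<union> {y \<in> S. x < y})" using that by auto
    also have "card \<dots> = Suc (card {y \<in> S. y < x} + card {y \<in> S. x < y})"
      using assms by (subst card_insert_disjoint) (auto intro!: card_Un_disjoint)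
    finally show ?thesis by simp
  qed
  then have "(\<Sum>x\<in>S. f (card {y \<in> S. x < y})) =
      (\<Sum>x\<in>S. f (card S - Suc (card {y \<in> S. y < x})))"
    by simp
  also have "\<dots> = (\<Sum>k<card S. f (card S - Suc k))"
    by (rule sum_card_less[OF assms])
  also have "\<dots> = (\<Sum>k<card S. f k)"
    by (rule sum.nat_diff_reindex)
  finally show ?thesis .
qed

section \<open>The mean weight over random arrival orders\<close>

text \<open>These are the power series coefficients of
  \<open>(1 - x) powr (- 2 * z)\<close>.\<close>

definition mean_weight :: "real \<Rightarrow> nat \<Rightarrow> real" where
  "mean_weight z n = pochhammer (2 * z) n / fact n"

lemma mean_weight_Suc: "mean_weight z (Suc n) = mean_weight z n * ((2 * z + n) / (n + 1))"
  by (simp add: mean_weight_def pochhammer_Suc field_simps)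

lemma sum_mean_weight: "2 * z * (\<Sum>k<n. mean_weight z k) = n * mean_weight z n"
proof (induction n)
  case (Suc n)
  have "2 * z * (\<Sum>k<Suc n. mean_weight z k) = (2 * z + n) * mean_weight z n"
    using Suc by (simp add: algebra_simps)
  then show ?case by (simp add: mean_weight_Suc field_simps)
qed simp

text \<open>Filtering is the first half of a partition, and the halves of a partitioned random
  permutation are uniform.\<close>

lemma map_pmf_filter_random_permutation:
  assumes "finite A"
  shows "map_pmf (filter Q) (pmf_of_set (permutations_of_set A)) =
           pmf_of_set (permutations_of_set {x \<in> A. Q x})"
proof -
  have "map_pmf (filter Q) (pmf_of_set (permutations_of_set A)) =
      map_pmf fst (map_pmf (partition Q) (pmf_of_set (permutations_of_set A)))"
    by (simp add: pmf.map_comp o_def)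
  then show ?thesis
    by (simp add: partition_random_permutations[OF assms] map_fst_pair_pmf)
qed

text \<open>Given the first element, the smaller and the larger ones each arrive in uniformly random
  order, so strong induction on the size applies to both.\<close>

lemma expectation_slot_weight:
  fixes S :: "'a::linorder set"
  assumes "finite S"
  shows "measure_pmf.expectation (pmf_of_set (permutations_of_set S)) (slot_weight z) =
           mean_weight z (card S)"
  using assms
proof (induction "card S" arbitrary: S rule: less_induct)
  case less
  let ?E = "\<lambda>A::'a set. measure_pmf.expectation (pmf_of_set (permutations_of_set A)) (slot_weight z)"
  show ?case
  proof (cases "S = {}")
    case True
    then show ?thesis by (simp add: mean_weight_def pmf_of_set_singleton)
  next
    case False
    let ?n = "card S"
    have n: "?n > 0" using False less.prems by (simp add: card_gt_0_iff)
    have first: "measure_pmf.expectation (pmf_of_set (permutations_of_set (S - {x}))) (\<lambda>xs. slot_weight z (x # xs))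
        = z * (mean_weight z (card {y \<in> S. y < x}) + mean_weight z (card {y \<in> S. x < y}))"
      if x: "x \<in> S" for x
    proof -
      let ?p = "pmf_of_set (permutations_of_set (S - {x}))"
      have fin: "finite (set_pmf ?p)" using less.prems by simp
      have filt: "measure_pmf.expectation ?p (\<lambda>xs. slot_weight z (filter Q xs)) =
          mean_weight z (card {y \<in> S - {x}. Q y})" for Q
      proof -
        have "measure_pmf.expectation ?p (\<lambda>xs. slot_weight z (filter Q xs)) = ?E {y \<in> S - {x}. Q y}"
          using less.prems by (subst map_pmf_filter_random_permutation[symmetric]) auto
        also have "card {y \<in> S - {x}. Q y} < ?n"
          using less.prems x by (intro psubset_card_mono) auto
        then have "?E {y \<in> S - {x}. Q y} = mean_weight z (card {y \<in> S - {x}. Q y})"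
          using less.prems by (intro less.hyps) auto
        finally show ?thesis .
      qed
      have "{y \<in> S - {x}. y < x} = {y \<in> S. y < x}" "{y \<in> S - {x}. \<not> y < x} = {y \<in> S. x < y}"
        by auto
      then show ?thesis
        using fin by (simp add: integrable_measure_pmf_finite filt)
    qed
    have "?E S = (\<Sum>x\<in>S. measure_pmf.expectation
        (pmf_of_set (permutations_of_set (S - {x}))) (\<lambda>xs. slot_weight z (x # xs))) / ?n"
      using less.prems False
      by (subst random_permutation_of_set)
        (auto simp: pmf_expectation_bind_pmf_of_set divide_inverse sum_distrib_left mult.commute simp del: slot_weight.simps
              simp flip: map_pmf_def)
    also have "\<dots> = (\<Sum>x\<in>S. z * (mean_weight z (card {y \<in> S. y < x}) +
        mean_weight z (card {y \<in> S. x < y}))) / ?n"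
      by (simp add: first del: slot_weight.simps)
    \<comment> \<open>Every rank occurs once, so both sides of the root contribute the same
      sum.\<close>
    also have "\<dots> = 2 * z * (\<Sum>k<?n. mean_weight z k) / ?n"
      by (simp add: sum_card_less[OF less.prems] sum_card_greater[OF less.prems] sum.distrib
            flip: sum_distrib_left)
    also have "\<dots> = mean_weight z ?n"
      using n by (simp add: sum_mean_weight)
    finally show ?thesis .
  qed
qed

text \<open>With \<open>a = 2 * z - 1\<close>, each growth factor \<open>1 + a / (n + 1)\<close> is
  at most \<open>exp (a / (n + 1))\<close>, hence at most \<open>((n + 1) / n) powr a\<close>, and
  these telescope.\<close>

lemma mean_weight_le:
  assumes "2 * z \<ge> 1" "n > 0"
  shows "mean_weight z n \<le> exp (2 * z - 1) * n powr (2 * z - 1)"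
  using assms(2)
proof (induction n rule: nat_induct_non_zero)
  case 1
  \<comment> \<open>The constant factor originates here, from
    \<open>2 * z \<le> exp (2 * z - 1)\<close>.\<close>
  show ?case using exp_ge_add_one_self[of "2 * z - 1"] by (simp add: mean_weight_def)
next
  case (Suc n)
  define a where "a = 2 * z - 1"
  have a: "a \<ge> 0" using assms by (simp add: a_def)
  have step: "exp (a / (n + 1)) \<le> ((n + 1) / n) powr a"
  proof -
    have "ln (1 - 1 / (real n + 1)) \<le> - (1 / (real n + 1))"
      using ln_le_minus_one[of "1 - 1 / (real n + 1)"] Suc.hyps by simp
    also have "1 - 1 / (real n + 1) = n / (n + 1)" by (simp add: field_simps)
    finally have "1 / (n + 1) \<le> ln ((real n + 1) / n)"
      using Suc.hyps by (simp add: ln_div add.commute)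
    from mult_left_mono[OF this a] show ?thesis
      using Suc.hyps by (simp add: powr_def add.commute)
  qed
  have "mean_weight z (Suc n) = mean_weight z n * (1 + a / (n + 1))"
    by (simp add: mean_weight_Suc a_def field_simps)
  also have "\<dots> \<le> (exp a * n powr a) * ((n + 1) / n) powr a"
  proof (intro mult_mono)
    show "mean_weight z n \<le> exp a * n powr a" using Suc.IH by (simp add: a_def)
    show "1 + a / (n + 1) \<le> ((n + 1) / n) powr a"
      using exp_ge_add_one_self[of "a / (n + 1)"] step by linarith
  qed (use a in auto)
  also have "\<dots> = exp a * (Suc n) powr a"
    using Suc.hyps by (simp add: powr_divide add.commute)
  finally show ?case by (simp add: a_def)
qed

lemma prob_overflow_le:
  fixes S :: "'a::linorder set"
  assumes "finite S" "S \<noteq> {}" "z \<ge> 1" "complete P"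
  shows "measure_pmf.prob (pmf_of_set (permutations_of_set S)) {xs. \<not> has_room (empty_slots P) xs}
           \<le> exp (2 * z - 1) * card S powr (2 * z - 1) / z ^ (height P + 1)"
proof -
  let ?p = "pmf_of_set (permutations_of_set S)"
  have int: "integrable (measure_pmf ?p) (slot_weight z)"
    using assms(1) by (intro integrable_measure_pmf_finite) simp
  have "measure_pmf.prob ?p {xs. \<not> has_room (empty_slots P) xs} \<le>
      measure_pmf.prob ?p {xs \<in> space ?p. z ^ (height P + 1) \<le> slot_weight z xs}"
    using slot_weight_ge_power[OF assms(3,4)] by (intro measure_pmf.finite_measure_mono) auto
  also have "\<dots> \<le> measure_pmf.expectation ?p (slot_weight z) / z ^ (height P + 1)"
    using assms(3) int order.trans[OF zero_le_one slot_weight_ge_1[OF assms(3)]]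
    by (intro integral_Markov_inequality_measure[where A = UNIV]) auto
  also have "\<dots> \<le> exp (2 * z - 1) * card S powr (2 * z - 1) / z ^ (height P + 1)"
    using mean_weight_le[of z "card S"] assms
    by (intro divide_right_mono) (auto simp: expectation_slot_weight card_gt_0_iff)
  finally show ?thesis .
qed


section \<open>The exponent\<close>

lemma bst_const_ln: "bst_const * ln (bst_const / 2) = bst_const - 1"
proof -
  have "ln (2 * exp 1 / bst_const) = 1 - ln (bst_const / 2)"
    using bst_const_bounds by (simp add: ln_div ln_mult)
  then have "bst_const * (1 - ln (bst_const / 2)) = 1" using bst_const_props(2) by metis
  then show ?thesis by (simp add: right_diff_distrib)
qed

text \<open>Maximality of the depth gives \<open>m + 1 \<le> 2 ^ (max_depth m + 2)\<close>; the
  exponent \<open>ln z / ln 2\<close> changes the base from 2 to \<open>z\<close>.\<close>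

lemma power_max_depth_ge:
  assumes "z \<ge> 1" "m \<ge> 1"
  shows "z ^ (max_depth m + 2) \<ge> m powr (ln z / ln 2)"
proof -
  have "m + 1 \<le> 2 ^ (max_depth m + 2)"
    using max_depth_bounds(2)[OF assms(2)] by linarith
  then have "real (m + 1) \<le> 2 ^ (max_depth m + 2)"
    by (metis of_nat_le_iff of_nat_power of_nat_numeral)
  then have "m powr (ln z / ln 2) \<le> (2 ^ (max_depth m + 2)) powr (ln z / ln 2)"
    using assms by (intro powr_mono2) auto
  also have "\<dots> = (2 powr (max_depth m + 2)) powr (ln z / ln 2)"
    by (subst powr_realpow) simp_all
  also have "\<dots> = z powr (max_depth m + 2)"
    using assms by (simp only: powr_powr) (simp add: powr_def)
  also have "\<dots> = z ^ (max_depth m + 2)"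
    using assms by (subst powr_realpow) simp_all
  finally show ?thesis .
qed

theorem theorem4p1:
  fixes \<epsilon> :: real
  assumes "\<epsilon> > 0"
  shows "\<exists>f :: nat \<Rightarrow> real. f \<in> o(\<lambda>_. 1) \<and>
    (\<forall>(n::nat) (m::nat) (S :: 'a::linorder set) (P :: nat tree) (fb :: 'a fallback).
       finite S \<longrightarrow> card S = n \<longrightarrow> real m \<ge> real n powr (bst_exponent + \<epsilon>) \<longrightarrow>
       position_tree m P \<longrightarrow> fallback_rule m fb \<longrightarrow>
       measure_pmf.prob (pmf_of_set (permutations_of_set S))
         {xs. inversions (binary_tree_alg P fb xs) = 0} \<ge> 1 - f n)"
proof -
  \<comment> \<open>Markov's bound vanishes once the exponent of \<open>n\<close> in
    \<open>m\<close> exceeds \<open>ln 2 * (2 * z - 1) / ln z\<close>. Over \<open>z > 1\<close>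
    this is least where \<open>2 * z * ln z = 2 * z - 1\<close>, that is at
    \<open>bst_const / 2\<close>, with value \<open>bst_exponent\<close>.\<close>
  define z where "z = bst_const / 2"
  define \<delta> where "\<delta> = \<epsilon> * ln z / ln 2"
  define f where "f = (\<lambda>n::nat. exp (2 * z - 1) * real n powr (- \<delta>))"
  have z: "z > 1" using bst_const_bounds by (simp add: z_def)
  have \<delta>: "\<delta> > 0" using z assms by (simp add: \<delta>_def)
  have "(bst_exponent + \<epsilon>) * (ln z / ln 2) = bst_const * ln z + \<delta>"
    by (simp add: bst_exponent_def \<delta>_def field_simps)
  also have "bst_const * ln z = 2 * z - 1"
    using bst_const_ln by (simp add: z_def)
  finally have exponent: "(bst_exponent + \<epsilon>) * (ln z / ln 2) = 2 * z - 1 + \<delta>" .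
  have "(\<lambda>n. real n powr (- \<delta>)) \<longlonglongrightarrow> 0"
    using \<delta> by (intro tendsto_neg_powr filterlim_real_sequentially) auto
  then have "f \<longlonglongrightarrow> 0"
    unfolding f_def by (rule tendsto_mult_right_zero)
  then have "f \<in> o(\<lambda>_. 1)" by (intro smalloI_tendsto) auto
  moreover have "1 - f (card S) \<le> measure_pmf.prob (pmf_of_set (permutations_of_set S))
         {xs. inversions (binary_tree_alg P fb xs) = 0}"
    if S: "finite S" and m: "real m \<ge> real (card S) powr (bst_exponent + \<epsilon>)"
      and P: "position_tree m P"
    for m and S :: "'a set" and P and fb :: "'a fallback"
  proof (cases "S = {}")
    case True
    \<comment> \<open>Here \<open>0 powr (- \<delta>)\<close> is 0, so probability 1 is required;
      the only arrival order is the empty list.\<close>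
    then show ?thesis
      by (simp add: f_def pmf_of_set_singleton binary_tree_alg_def inversions_def)
  next
    case False
    let ?p = "pmf_of_set (permutations_of_set S)" and ?n = "card S"
    let ?R = "{xs. has_room (empty_slots P) xs} :: 'a list set"
    \<comment> \<open>\<open>height P\<close> counts levels, which is one more than the maximal
      depth; overflow adds another.\<close>
    from P have P': "complete P" "bst P" "height P + 1 = max_depth m + 2"
      by (auto simp: position_tree_def)
    have n: "?n > 0" using S False by (simp add: card_gt_0_iff)
    then have "0 < real ?n powr (bst_exponent + \<epsilon>)" by simp
    with m have "m \<ge> 1" by linarith
    have "?n powr (2 * z - 1 + \<delta>) = (?n powr (bst_exponent + \<epsilon>)) powr (ln z / ln 2)"
      by (simp only: powr_powr exponent)
    also have "\<dots> \<le> m powr (ln z / ln 2)"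
      using m z by (intro powr_mono2) auto
    also have "\<dots> \<le> z ^ (height P + 1)"
      using power_max_depth_ge[of z m] z \<open>m \<ge> 1\<close> unfolding P'(3) by simp
    finally have pow: "?n powr (2 * z - 1 + \<delta>) \<le> z ^ (height P + 1)" .
    have "measure_pmf.prob ?p (- ?R) \<le> exp (2 * z - 1) * ?n powr (2 * z - 1) / z ^ (height P + 1)"
      using prob_overflow_le[OF S False _ P'(1), of z] z by (simp add: Collect_neg_eq)
    also have "\<dots> \<le> exp (2 * z - 1) * ?n powr (2 * z - 1) / ?n powr (2 * z - 1 + \<delta>)"
      using pow n z by (intro divide_left_mono) auto
    also have "\<dots> = f ?n"
      using n by (simp add: f_def powr_add[of _ "2 * z - 1" \<delta>] powr_minus divide_inverse)
    finally have "1 - f ?n \<le> measure_pmf.prob ?p ?R"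
      using measure_pmf.prob_compl[of ?R ?p] by (simp add: Compl_eq_Diff_UNIV)
    also have "\<dots> \<le> measure_pmf.prob ?p {xs. inversions (binary_tree_alg P fb xs) = 0}"
      using inversions_eq_0_if_has_room[OF P'(2)]
      by (intro measure_pmf.finite_measure_mono) auto
    finally show ?thesis .
  qed
  ultimately show ?thesis by blast
qed

end
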